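(* Let $K$ be a positive integer, let $\mathcal P$ be an infinite set of prime numbers, and let $\varepsilon$ and $\kappa$ be positive real numbers with $\kappa<1$. For $k=1,\ldots,K$, let $\{a_{k,n}\}_{n=1}^\infty$ and $\{b_{k,n}\}_{n=1}^\infty$ be sequences of non-zero integers, and set $a_{0,n}=1$. Suppose that for all $p\in\mathcal P$ and $k=1,\ldots,K$: $p\nmid\gcd(a_{k,n},b_{k,n})$ for all $n$; for all sufficiently large $N$ there is exactly one $n\le N$ with $\nu_p(a_{k,n})=\max_{1\le m\le N}\nu_p(a_{k,m})$; and, if $k>1$, \[\lim_{N\to\infty}\frac{\max_{1\le n\le N}\nu_p(a_{k,n})}{1+\max_{1\le n\le N}\nu_p(a_{k-1,n})}=\infty.\] Suppose there is a non-decreasing sequence $\{a_n\}_{n=1}^\infty$ of positive integers and an integer $A_0$ such that for each $k=1,\ldots,K$, each integer $A\ge A_0$ and all sufficiently large $n$: \[ n^{1+\varepsilon}\le a_n\le a_{n+1},\qquad |b_{k,n}|\le 2^{(\log_2 a_n)^\kappa},\qquad a_n2^{-(\log_2 a_n)^\kappa}\le|a_{k,n}|\le\max\big\{a_n2^{(\log_2 a_n)^\kappa},2^{A^n}\big\},\] and for each integer $A\ge A_0$, $\limsup_{n\to\infty}a_n^{1/A^n}=\infty$. For $k=1,\ldots,K$ set $\alpha_k=\sum_{n=1}^\infty\frac{b_{k,n}}{a_{k,n}}$. Then $\alpha_1,\ldots,\alpha_K$ are algebraically independent over $\mathbb Q$.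
   Context: $\nu_p$ denotes the $p$-adic valuation. *)

theory Defs
  imports "HOL-Analysis.Analysis" "HOL-Library.Liminf_Limsup" "HOL-Computational_Algebra.Primes"
begin

text \<open>Algebraic independence over the rationals of the real numbers alpha 1, ..., alpha K:
  the monomials in alpha 1, ..., alpha K (exponent vectors supported on 1..K) are linearly
  independent over the rationals, i.e. no non-zero polynomial with rational coefficients
  in K variables vanishes at (alpha 1, ..., alpha K).\<close>
definition alg_indep_over_rat :: "nat \<Rightarrow> (nat \<Rightarrow> real) \<Rightarrow> bool" where
  "alg_indep_over_rat K alpha \<longleftrightarrow>
     (\<forall>S (c :: (nat \<Rightarrow> nat) \<Rightarrow> rat).
        finite S \<and> S \<subseteq> {e. \<forall>i. i \<notin> {1..K} \<longrightarrow> e i = 0} \<and>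
        (\<Sum>e\<in>S. of_rat (c e) * (\<Prod>i\<in>{1..K}. alpha i ^ e i)) = 0
        \<longrightarrow> (\<forall>e\<in>S. c e = 0))"

definition padic_val :: "nat \<Rightarrow> int \<Rightarrow> nat" where
  "padic_val p x = multiplicity (int p) x"

definition maxval :: "nat \<Rightarrow> (nat \<Rightarrow> int) \<Rightarrow> nat \<Rightarrow> nat" where
  "maxval p f N = Max {padic_val p (f m) | m. 1 \<le> m \<and> m \<le> N}"

end

theory Submission
  imports Defs "HOL-Library.Landau_Symbols"
begin

text \<open>
  Let \<open>F\<close> be a non-zero rational polynomial vanishing at \<open>(\<alpha>\<^sub>1, \<dots>, \<alpha>\<^sub>K)\<close>, and choose \<open>p \<in> P\<close> prime to
  the numerators and denominators of its coefficients. The \<open>N\<close>-th partial sum of \<open>\<alpha>\<^sub>k\<close> has a p-adic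
  pole of order exactly \<open>maxval p (a k) N\<close>, and these orders grow so much faster with each \<open>k\<close> that
  distinct monomials of \<open>F\<close> have distinct pole orders; so \<open>F\<close> does not vanish at the partial sums
  and is there at least the reciprocal of a common denominator. On the other hand its value is
  \<open>O(aa (N + 1) powr (- \<eta>))\<close> with \<open>\<eta>\<close> depending only on \<open>\<epsilon>\<close>. The two bounds conflict when
  \<open>N + 1\<close> is a record index of \<open>log 2 (aa n) / B ^ n\<close> for a large \<open>B\<close>: the denominator is then at most
  \<open>aa (N + 1)\<close> to a small power.
\<close>

subsection \<open>Orders of p-adic poles\<close>

text \<open>\<open>pole_lt p x m\<close> means \<open>\<nu>\<^sub>p x > - m\<close> and \<open>pole_eq p x m\<close> means \<open>\<nu>\<^sub>p x = - m\<close>, for rational \<open>x\<close>.\<close>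

definition pole_lt :: "nat \<Rightarrow> real \<Rightarrow> nat \<Rightarrow> bool" where
  "pole_lt p x m \<longleftrightarrow>
     (\<exists>u w :: int. \<not> int p dvd w \<and> x * real p ^ m * real_of_int w = real_of_int (int p * u))"

definition pole_eq :: "nat \<Rightarrow> real \<Rightarrow> nat \<Rightarrow> bool" where
  "pole_eq p x m \<longleftrightarrow>
     (\<exists>u w :: int. \<not> int p dvd u \<and> \<not> int p dvd w \<and>
        x * real p ^ m * real_of_int w = real_of_int u)"

lemma pole_eq_nonzero:
  assumes "pole_eq p x m"
  shows "x \<noteq> 0"
  using assms by (auto simp: pole_eq_def)

lemma pole_lt_0:
  assumes "prime p"
  shows "pole_lt p 0 m"
  unfolding pole_lt_def using assms prime_gt_1_nat[of p]
  by (intro exI[of _ 0] exI[of _ 1]) auto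

lemma pole_lt_add:
  assumes p: "prime p" and "pole_lt p x m" "pole_lt p y m"
  shows "pole_lt p (x + y) m"
proof -
  from assms obtain u w u' w' where
    1: "\<not> int p dvd w" "x * real p ^ m * real_of_int w = real_of_int (int p * u)" and
    2: "\<not> int p dvd w'" "y * real p ^ m * real_of_int w' = real_of_int (int p * u')"
    unfolding pole_lt_def by auto
  have "\<not> int p dvd w * w'"
    using 1(1) 2(1) p by (simp add: prime_dvd_mult_iff)
  moreover have "(x + y) * real p ^ m * real_of_int (w * w') =
      (x * real p ^ m * real_of_int w) * real_of_int w' +
      (y * real p ^ m * real_of_int w') * real_of_int w"
    by (simp add: algebra_simps)
  then have "(x + y) * real p ^ m * real_of_int (w * w') =
      real_of_int (int p * (u * w' + u' * w))"
    unfolding 1(2) 2(2) by (simp add: algebra_simps)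
  ultimately show ?thesis
    unfolding pole_lt_def by blast
qed

lemma pole_lt_sum:
  assumes "prime p" and "\<And>i. i \<in> I \<Longrightarrow> pole_lt p (f i) m"
  shows "pole_lt p (\<Sum>i\<in>I. f i) m"
  using assms(2)
  by (induction I rule: infinite_finite_induct) (auto intro: pole_lt_0 pole_lt_add assms(1))

text \<open>After cross-multiplication the numerator is \<open>u * w'\<close> plus a multiple of
  \<open>p\<close>, so its residue modulo \<open>p\<close> stays non-zero.\<close>

lemma pole_eq_add_pole_lt:
  assumes p: "prime p" and "pole_eq p x m" "pole_lt p y m"
  shows "pole_eq p (x + y) m"
proof -
  from assms obtain u w u' w' where
    1: "\<not> int p dvd w" "x * real p ^ m * real_of_int w = real_of_int u" and
    2: "\<not> int p dvd w'" "y * real p ^ m * real_of_int w' = real_of_int (int p * u')" and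
    3: "\<not> int p dvd u"
    unfolding pole_lt_def pole_eq_def by auto
  have "\<not> int p dvd w * w'" and 4: "\<not> int p dvd u * w'"
    using 1(1) 2(1) 3 p by (simp_all add: prime_dvd_mult_iff)
  moreover have "(x + y) * real p ^ m * real_of_int (w * w') =
      (x * real p ^ m * real_of_int w) * real_of_int w' +
      (y * real p ^ m * real_of_int w') * real_of_int w"
    by (simp add: algebra_simps)
  then have "(x + y) * real p ^ m * real_of_int (w * w') =
      real_of_int (u * w' + int p * (u' * w))"
    unfolding 1(2) 2(2) by (simp add: algebra_simps)
  moreover have "\<not> int p dvd u * w' + int p * (u' * w)"
    using 4 by (simp add: dvd_add_left_iff)
  ultimately show ?thesis
    unfolding pole_eq_def by blast
qed

text \<open>Ultrametric principle: a strictly dominant pole cannot be cancelled. It is applied to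
  partial sums, where one term dominates, and to polynomials, where one monomial does.\<close>

lemma pole_eq_sum_dominant:
  assumes p: "prime p" and "finite I" "i \<in> I" "pole_eq p (f i) m"
    and "\<And>j. j \<in> I \<Longrightarrow> j \<noteq> i \<Longrightarrow> pole_lt p (f j) m"
  shows "pole_eq p (\<Sum>j\<in>I. f j) m"
proof -
  have "(\<Sum>j\<in>I. f j) = f i + (\<Sum>j\<in>I - {i}. f j)"
    using assms by (simp add: sum.remove)
  then show ?thesis
    using assms by (auto intro!: pole_eq_add_pole_lt pole_lt_sum)
qed

lemma pole_eq_imp_pole_lt:
  assumes "pole_eq p x m" "m < n"
  shows "pole_lt p x n"
proof -
  from assms(1) obtain u w where
    1: "\<not> int p dvd w" "x * real p ^ m * real_of_int w = real_of_int u"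
    unfolding pole_eq_def by auto
  obtain d where d: "n = m + Suc d"
    using assms(2) less_iff_Suc_add by auto
  have "x * real p ^ n * real_of_int w = (x * real p ^ m * real_of_int w) * real p * real p ^ d"
    by (simp add: d power_add)
  also have "\<dots> = real_of_int (int p * (u * int p ^ d))"
    unfolding 1(2) by simp
  finally show ?thesis
    using 1(1) unfolding pole_lt_def by blast
qed

lemma pole_eq_1:
  assumes "prime p"
  shows "pole_eq p 1 0"
  unfolding pole_eq_def using assms prime_gt_1_nat[of p]
  by (intro exI[of _ 1]) auto

lemma pole_eq_mult:
  assumes p: "prime p" and "pole_eq p x m" "pole_eq p y n"
  shows "pole_eq p (x * y) (m + n)"
proof -
  from assms obtain u w u' w' where
    1: "\<not> int p dvd u" "\<not> int p dvd w" "x * real p ^ m * real_of_int w = real_of_int u" and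
    2: "\<not> int p dvd u'" "\<not> int p dvd w'" "y * real p ^ n * real_of_int w' = real_of_int u'"
    unfolding pole_eq_def by auto
  have "(x * y) * real p ^ (m + n) * real_of_int (w * w') =
      (x * real p ^ m * real_of_int w) * (y * real p ^ n * real_of_int w')"
    by (simp add: power_add mult_ac)
  also have "\<dots> = real_of_int (u * u')"
    unfolding 1(3) 2(3) by simp
  finally have "(x * y) * real p ^ (m + n) * real_of_int (w * w') = real_of_int (u * u')" .
  moreover have "\<not> int p dvd u * u'" "\<not> int p dvd w * w'"
    using 1 2 p by (simp_all add: prime_dvd_mult_iff)
  ultimately show ?thesis
    unfolding pole_eq_def by blast
qed

lemma pole_eq_power:
  assumes "prime p" "pole_eq p x m"
  shows "pole_eq p (x ^ e) (e * m)"
  by (induction e) (auto intro: pole_eq_1 pole_eq_mult assms)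

lemma pole_eq_prod:
  assumes "prime p" "\<And>i. i \<in> I \<Longrightarrow> pole_eq p (f i) (m i)"
  shows "pole_eq p (\<Prod>i\<in>I. f i) (\<Sum>i\<in>I. m i)"
  using assms(2)
  by (induction I rule: infinite_finite_induct) (auto intro: pole_eq_1 pole_eq_mult assms(1))

lemma pole_eq_fraction:
  assumes p: "prime p" and "x \<noteq> 0" "\<not> int p dvd y"
  shows "pole_eq p (real_of_int y / real_of_int x) (padic_val p x)"
proof -
  from p have np: "\<not> is_unit (int p)"
    using prime_gt_1_nat[of p] by auto
  obtain z where z: "x = int p ^ padic_val p x * z" "\<not> int p dvd z"
    using multiplicity_decompose'[OF assms(2) np] unfolding padic_val_def by metis
  have "real_of_int x = real p ^ padic_val p x * real_of_int z"
    using arg_cong[OF z(1), of real_of_int] by simp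
  then have "real_of_int y / real_of_int x * (real p ^ padic_val p x * real_of_int z) =
      real_of_int y / real_of_int x * real_of_int x"
    by (simp only:)
  also have "\<dots> = real_of_int y"
    using assms(2) by simp
  finally have "real_of_int y / real_of_int x * real p ^ padic_val p x * real_of_int z = real_of_int y"
    by (simp only: mult.assoc)
  then show ?thesis
    unfolding pole_eq_def using assms z by blast
qed

text \<open>A factor \<open>p\<close> in \<open>y\<close> only lowers the pole, so the bound is
  proved for \<open>1 / x\<close> and multiplied through by \<open>y\<close>.\<close>

lemma pole_lt_fraction:
  assumes p: "prime p" and "x \<noteq> 0" "padic_val p x < m"
  shows "pole_lt p (real_of_int y / real_of_int x) m"
proof -
  have "pole_eq p (real_of_int 1 / real_of_int x) (padic_val p x)"
    using assms prime_gt_1_nat[of p] by (intro pole_eq_fraction) auto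
  then have "pole_lt p (1 / real_of_int x) m"
    using assms pole_eq_imp_pole_lt by auto
  then obtain u w where 1: "\<not> int p dvd w"
      "1 / real_of_int x * real p ^ m * real_of_int w = real_of_int (int p * u)"
    unfolding pole_lt_def by auto
  have "real_of_int y / real_of_int x * real p ^ m * real_of_int w =
      real_of_int y * (1 / real_of_int x * real p ^ m * real_of_int w)"
    by simp
  also have "\<dots> = real_of_int (int p * (u * y))"
    unfolding 1(2) by simp
  finally show ?thesis
    unfolding pole_lt_def using 1(1) by blast
qed

lemma padic_val_le_maxval:
  assumes "1 \<le> n" "n \<le> N"
  shows "padic_val p (f n) \<le> maxval p f N"
  unfolding maxval_def using assms by (intro Max_ge) auto

text \<open>The term whose denominator has the unique maximal valuation dominates. As that valuation
  is positive, \<open>cop\<close> makes its numerator prime to \<open>p\<close>, so nothing cancels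
  within the term.\<close>

lemma pole_eq_partial_sum:
  assumes p: "prime p"
    and nz: "\<And>n. 1 \<le> n \<Longrightarrow> x n \<noteq> 0"
    and cop: "\<And>n. 1 \<le> n \<Longrightarrow> \<not> int p dvd gcd (x n) (y n)"
    and ex1: "\<exists>!n. 1 \<le> n \<and> n \<le> N \<and> padic_val p (x n) = maxval p x N"
    and N: "2 \<le> N"
  shows "0 < maxval p x N"
    and "pole_eq p (\<Sum>n<N. real_of_int (y (n + 1)) / real_of_int (x (n + 1))) (maxval p x N)"
proof -
  from ex1 obtain n where n: "1 \<le> n" "n \<le> N" "padic_val p (x n) = maxval p x N"
    and uniq: "\<And>n'. 1 \<le> n' \<Longrightarrow> n' \<le> N \<Longrightarrow> padic_val p (x n') = maxval p x N \<Longrightarrow> n' = n"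
    by blast
  have less: "padic_val p (x n') < maxval p x N" if "1 \<le> n'" "n' \<le> N" "n' \<noteq> n" for n'
    using padic_val_le_maxval[OF that(1,2), of p x] uniq[OF that(1,2)] that(3)
    by (meson le_neq_implies_less)
  \<comment> \<open>Among two or more indices, one other than \<open>n\<close> has a valuation
    strictly below the maximum.\<close>
  show pos: "0 < maxval p x N"
  proof (cases "n = 1")
    case True
    then show ?thesis using less[of 2] N by simp
  next
    case False
    then show ?thesis using less[of 1] N by simp
  qed
  have "int p dvd x n"
  proof (rule ccontr)
    assume "\<not> int p dvd x n"
    then have "padic_val p (x n) = 0"
      unfolding padic_val_def by (rule not_dvd_imp_multiplicity_0)
    with pos n(3) show False by simp
  qed
  with cop[OF n(1)] have "\<not> int p dvd y n"
    by simp
  then have "pole_eq p (real_of_int (y n) / real_of_int (x n)) (maxval p x N)"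
    using pole_eq_fraction[OF p nz[OF n(1)]] n(3) by simp
  then show "pole_eq p (\<Sum>n<N. real_of_int (y (n + 1)) / real_of_int (x (n + 1))) (maxval p x N)"
  \<comment> \<open>The sum is indexed from \<open>0\<close> and the sequences from
    \<open>1\<close>, hence \<open>n - 1\<close>.\<close>
  proof (intro pole_eq_sum_dominant[OF p, where i = "n - 1"])
    fix j assume "j \<in> {..<N}" "j \<noteq> n - 1"
    then show "pole_lt p (real_of_int (y (j + 1)) / real_of_int (x (j + 1))) (maxval p x N)"
      using n by (intro pole_lt_fraction[OF p] nz less) auto
  qed (use n in auto)
qed

text \<open>Positional notation: the \<open>M k\<close> are place values and the \<open>e k\<close>
  digits at most \<open>D\<close>; each place is worth at least \<open>D + 1\<close> times the one
  before, so lower digits never carry.\<close>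

lemma weighted_sum_less:
  fixes M e :: "nat \<Rightarrow> nat"
  assumes "\<And>k. k \<in> {1..K} \<Longrightarrow> e k \<le> D" "0 < M 1"
    and "\<And>k. 1 < k \<Longrightarrow> k \<le> Suc K \<Longrightarrow> (D + 1) * M (k - 1) \<le> M k"
  shows "(\<Sum>k=1..K. e k * M k) < M (Suc K)"
  using assms
proof (induction K)
  case 0
  then show ?case by simp
next
  case (Suc K)
  have "(\<Sum>k=1..K. e k * M k) < M (Suc K)"
    by (intro Suc.IH) (use Suc.prems in auto)
  moreover have "e (Suc K) * M (Suc K) \<le> D * M (Suc K)"
    using Suc.prems(1)[of "Suc K"] by simp
  moreover have "D * M (Suc K) + M (Suc K) \<le> M (Suc (Suc K))"
    using Suc.prems(3)[of "Suc (Suc K)"] by simp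
  ultimately have "(\<Sum>k=1..K. e k * M k) + e (Suc K) * M (Suc K) < M (Suc (Suc K))"
    by linarith
  then show ?case by simp
qed

text \<open>Uniqueness of digits: division by the leading place value recovers the leading digit,
  and induction the others.\<close>

lemma weighted_sum_inj:
  fixes M e e' :: "nat \<Rightarrow> nat"
  assumes "\<And>k. k \<in> {1..K} \<Longrightarrow> e k \<le> D" "\<And>k. k \<in> {1..K} \<Longrightarrow> e' k \<le> D" "0 < M 1"
    and "\<And>k. 1 < k \<Longrightarrow> k \<le> K \<Longrightarrow> (D + 1) * M (k - 1) \<le> M k"
    and "(\<Sum>k=1..K. e k * M k) = (\<Sum>k=1..K. e' k * M k)"
  shows "\<forall>k\<in>{1..K}. e k = e' k"
  using assms
proof (induction K)
  case 0
  then show ?case by simp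
next
  case (Suc K)
  have less: "(\<Sum>k=1..K. e k * M k) < M (Suc K)" "(\<Sum>k=1..K. e' k * M k) < M (Suc K)"
    by (rule weighted_sum_less[where D = D]; use Suc.prems in auto)+
  have eq: "(\<Sum>k=1..K. e k * M k) + e (Suc K) * M (Suc K) =
      (\<Sum>k=1..K. e' k * M k) + e' (Suc K) * M (Suc K)"
    using Suc.prems(5) by simp
  then have "((\<Sum>k=1..K. e k * M k) + e (Suc K) * M (Suc K)) div M (Suc K) =
      ((\<Sum>k=1..K. e' k * M k) + e' (Suc K) * M (Suc K)) div M (Suc K)"
    by simp
  then have top: "e (Suc K) = e' (Suc K)"
    using less by simp
  have "\<forall>k\<in>{1..K}. e k = e' k"
    by (rule Suc.IH) (use Suc.prems eq top in auto)
  then show ?case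
    using top by (auto simp: le_Suc_eq)
qed

lemma pole_eq_of_rat:
  assumes "prime p" and "\<not> int p dvd fst (quotient_of c)" "\<not> int p dvd snd (quotient_of c)"
  shows "pole_eq p (of_rat c) 0"
proof -
  obtain u w where uw: "quotient_of c = (u, w)" by fastforce
  then have "c = of_int u / of_int w" "w > 0"
    by (auto simp: quotient_of_div quotient_of_denom_pos)
  then have "of_rat c * real_of_int w = real_of_int u"
    by (simp add: of_rat_divide)
  then show ?thesis
    unfolding pole_eq_def using assms uw by (intro exI[of _ u] exI[of _ w]) auto
qed

text \<open>A non-zero integer has only finitely many divisors, so \<open>Z\<close> excludes only
  finitely many members of \<open>P\<close>.\<close>

lemma exists_prime_avoiding:
  fixes P :: "nat set" and Z :: "int set"
  assumes "infinite P" "finite Z" "0 \<notin> Z"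
  shows "\<exists>p\<in>P. \<forall>z\<in>Z. \<not> int p dvd z"
proof -
  have "finite (\<Union>z\<in>Z. {p. int p dvd z})"
  proof (intro finite_UN_I assms(2))
    fix z assume "z \<in> Z"
    then have "z \<noteq> 0" using assms(3) by auto
    have "p \<le> nat \<bar>z\<bar>" if "int p dvd z" for p
      using dvd_imp_le_int[OF \<open>z \<noteq> 0\<close> that] by simp
    then have "{p. int p dvd z} \<subseteq> {..nat \<bar>z\<bar>}"
      by auto
    then show "finite {p. int p dvd z}"
      using finite_subset by blast
  qed
  then obtain p where "p \<in> P" "p \<notin> (\<Union>z\<in>Z. {p. int p dvd z})"
    using assms(1) by (meson finite_subset subsetI)
  then show ?thesis by auto
qed

text \<open>The coefficients are p-adic units, so the monomial of \<open>e\<close> has a pole whose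
  order is the number with digits \<open>e k\<close> and place values \<open>M k\<close>. Distinct
  exponent vectors thus give distinct orders, and the monomial with the largest order
  dominates.\<close>

lemma polynomial_nonzero_of_poles:
  fixes \<beta> :: "nat \<Rightarrow> real" and M :: "nat \<Rightarrow> nat" and c :: "(nat \<Rightarrow> nat) \<Rightarrow> rat"
  assumes p: "prime p" and S: "finite S" "S \<noteq> {}" "S \<subseteq> {e. \<forall>i. i \<notin> {1..K} \<longrightarrow> e i = 0}"
    and D: "\<And>e k. e \<in> S \<Longrightarrow> k \<in> {1..K} \<Longrightarrow> e k \<le> D"
    and c: "\<And>e. e \<in> S \<Longrightarrow> pole_eq p (of_rat (c e)) 0"
    and \<beta>: "\<And>k. k \<in> {1..K} \<Longrightarrow> pole_eq p (\<beta> k) (M k)"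
    and M: "0 < M 1" "\<And>k. 1 < k \<Longrightarrow> k \<le> K \<Longrightarrow> (D + 1) * M (k - 1) \<le> M k"
  shows "(\<Sum>e\<in>S. of_rat (c e) * (\<Prod>i\<in>{1..K}. \<beta> i ^ e i)) \<noteq> 0"
proof -
  define s where "s e = (\<Sum>k=1..K. e k * M k)" for e
  have inj: "e = e'" if "e \<in> S" "e' \<in> S" "s e = s e'" for e e'
  proof
    fix k
    have "\<forall>k\<in>{1..K}. e k = e' k"
      using that D M unfolding s_def by (intro weighted_sum_inj[of K e D e' M]) auto
    moreover have "e k = 0 \<and> e' k = 0" if "k \<notin> {1..K}"
      using that \<open>e \<in> S\<close> \<open>e' \<in> S\<close> S(3) by blast
    ultimately show "e k = e' k"
      by (cases "k \<in> {1..K}") simp_all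
  qed
  have pole: "pole_eq p (of_rat (c e) * (\<Prod>i\<in>{1..K}. \<beta> i ^ e i)) (s e)" if "e \<in> S" for e
    using pole_eq_mult[OF p c[OF that]
        pole_eq_prod[OF p, of "{1..K}" "\<lambda>i. \<beta> i ^ e i" "\<lambda>i. e i * M i"]]
      pole_eq_power[OF p \<beta>]
    unfolding s_def by simp
  have "Max (s ` S) \<in> s ` S"
    using S by (intro Max_in) auto
  then obtain e where e: "e \<in> S" "s e = Max (s ` S)"
    by auto
  have "pole_eq p (\<Sum>e\<in>S. of_rat (c e) * (\<Prod>i\<in>{1..K}. \<beta> i ^ e i)) (s e)"
  proof (rule pole_eq_sum_dominant[OF p S(1) e(1)])
    show "pole_eq p (of_rat (c e) * (\<Prod>i\<in>{1..K}. \<beta> i ^ e i)) (s e)"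
      by (rule pole[OF e(1)])
  next
    fix e' assume e': "e' \<in> S" "e' \<noteq> e"
    then have "s e' \<le> s e" "s e' \<noteq> s e"
      using e S inj by auto
    then show "pole_lt p (of_rat (c e') * (\<Prod>i\<in>{1..K}. \<beta> i ^ e' i)) (s e)"
      using pole_eq_imp_pole_lt[OF pole[OF e'(1)]] by simp
  qed
  then show ?thesis
    by (rule pole_eq_nonzero)
qed

subsection \<open>Approximation by partial sums\<close>

text \<open>Write \<open>f g - l m\<close> as \<open>(f - l)(g - m) + l (g - m) + m (f - l)\<close>;
  boundedness of \<open>t\<close> keeps the quadratic term in \<open>O(t)\<close>.\<close>

lemma bigo_diff_mult:
  fixes f g t :: "nat \<Rightarrow> real"
  assumes f: "(\<lambda>N. f N - l) \<in> O(t)" and g: "(\<lambda>N. g N - m) \<in> O(t)" and t: "t \<in> O(\<lambda>_. 1)"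
  shows "(\<lambda>N. f N * g N - l * m) \<in> O(t)"
proof -
  have "(\<lambda>N. (f N - l) * (g N - m)) \<in> O(\<lambda>N. t N * 1)"
    using f landau_o.big.trans[OF g t] by (rule landau_o.big.mult)
  moreover have "(\<lambda>N. l * (g N - m)) \<in> O(t)" "(\<lambda>N. m * (f N - l)) \<in> O(t)"
    using f g by auto
  ultimately have "(\<lambda>N. (f N - l) * (g N - m) + (l * (g N - m) + m * (f N - l))) \<in> O(t)"
    by (intro sum_in_bigo) auto
  then show ?thesis
    by (simp add: algebra_simps)
qed

lemma bigo_diff_power:
  fixes f t :: "nat \<Rightarrow> real"
  assumes "(\<lambda>N. f N - l) \<in> O(t)" "t \<in> O(\<lambda>_. 1)"
  shows "(\<lambda>N. f N ^ e - l ^ e) \<in> O(t)"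
  using assms by (induction e) (auto intro: bigo_diff_mult)

lemma bigo_diff_prod:
  fixes f :: "nat \<Rightarrow> 'i \<Rightarrow> real" and t :: "nat \<Rightarrow> real"
  assumes "\<And>i. i \<in> I \<Longrightarrow> (\<lambda>N. f N i - l i) \<in> O(t)" "t \<in> O(\<lambda>_. 1)"
  shows "(\<lambda>N. (\<Prod>i\<in>I. f N i) - (\<Prod>i\<in>I. l i)) \<in> O(t)"
  using assms(1)
  by (induction I rule: infinite_finite_induct) (auto intro!: bigo_diff_mult assms(2))

text \<open>Polynomials are locally Lipschitz, so errors \<open>O(t)\<close> in the variables cause
  an error \<open>O(t)\<close> in the value.\<close>

lemma bigo_diff_polynomial:
  fixes \<beta> :: "nat \<Rightarrow> nat \<Rightarrow> real" and t :: "nat \<Rightarrow> real" and c :: "(nat \<Rightarrow> nat) \<Rightarrow> real"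
  assumes "\<And>i. i \<in> I \<Longrightarrow> (\<lambda>N. \<beta> N i - \<alpha> i) \<in> O(t)" "t \<in> O(\<lambda>_. 1)"
  shows "(\<lambda>N. (\<Sum>e\<in>S. c e * (\<Prod>i\<in>I. \<beta> N i ^ e i)) - (\<Sum>e\<in>S. c e * (\<Prod>i\<in>I. \<alpha> i ^ e i))) \<in> O(t)"
proof -
  have "(\<lambda>N. \<Sum>e\<in>S. c e * ((\<Prod>i\<in>I. \<beta> N i ^ e i) - (\<Prod>i\<in>I. \<alpha> i ^ e i))) \<in> O(t)"
  proof (intro big_sum_in_bigo)
    fix e
    have "(\<lambda>N. (\<Prod>i\<in>I. \<beta> N i ^ e i) - (\<Prod>i\<in>I. \<alpha> i ^ e i)) \<in> O(t)"
      by (intro bigo_diff_prod bigo_diff_power assms)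
    then show "(\<lambda>N. c e * ((\<Prod>i\<in>I. \<beta> N i ^ e i) - (\<Prod>i\<in>I. \<alpha> i ^ e i))) \<in> O(t)"
      by (cases "c e = 0") simp_all
  qed
  then show ?thesis
    by (simp add: right_diff_distrib sum_subtractf)
qed

text \<open>Since \<open>g\<close> is monotone, a small power \<open>g N powr (- \<eta>)\<close> can be pulled out of the tail while
  the remaining power of \<open>g n\<close> is still summable.\<close>
lemma tail_bigo:
  fixes f g :: "nat \<Rightarrow> real" and \<epsilon> :: real
  defines "\<eta> \<equiv> \<epsilon> / (4 * (1 + \<epsilon>))"
  assumes \<epsilon>: "\<epsilon> > 0" and mono: "incseq g" and pos: "\<And>n. g n > 0"
    and f: "\<forall>\<^sub>F n in sequentially. \<bar>f n\<bar> \<le> g n powr (\<eta> - 1)"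
    and g: "\<forall>\<^sub>F n in sequentially. real (n + 1) powr (1 + \<epsilon>) \<le> g n"
  shows "summable f"
    and "(\<lambda>N. (\<Sum>n<N. f n) - suminf f) \<in> O(\<lambda>N. g N powr (- \<eta>))"
proof -
  \<comment> \<open>\<open>h\<close> is the summable majorant left once
    \<open>g N powr (- \<eta>)\<close> is pulled out; \<open>\<eta>\<close> is chosen to make its
    exponent \<open>(1 + \<epsilon>) * (2 * \<eta> - 1)\<close>.\<close>
  define h where "h n = real (n + 1) powr (- 1 - \<epsilon> / 2)" for n
  have \<eta>: "0 < \<eta>" "2 * \<eta> < 1" "(1 + \<epsilon>) * (2 * \<eta> - 1) = - 1 - \<epsilon> / 2"
    unfolding \<eta>_def using \<epsilon> by (auto simp: field_simps)
  have "summable (\<lambda>n. real n powr (- 1 - \<epsilon> / 2))"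
    using \<epsilon> by (subst summable_real_powr_iff) auto
  then have h: "summable h"
    unfolding h_def using summable_Suc_iff[of "\<lambda>n. real n powr (- 1 - \<epsilon> / 2)"] by simp
  have h0: "h n \<ge> 0" for n
    by (simp add: h_def)
  obtain n0 where n0: "\<And>n. n \<ge> n0 \<Longrightarrow> \<bar>f n\<bar> \<le> g n powr (\<eta> - 1)"
      "\<And>n. n \<ge> n0 \<Longrightarrow> real (n + 1) powr (1 + \<epsilon>) \<le> g n"
    using eventually_conj[OF f g] unfolding eventually_sequentially by blast
  have bound: "\<bar>f n\<bar> \<le> g N powr (- \<eta>) * h n" if "n \<ge> N" "N \<ge> n0" for n N
  proof -
    \<comment> \<open>Both parts of the split exponent are negative, so monotonicity of
      \<open>g\<close> bounds the first factor and its growth the second.\<close>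
    have "\<bar>f n\<bar> \<le> g n powr (- \<eta>) * g n powr (2 * \<eta> - 1)"
      using n0(1)[of n] that by (simp flip: powr_add)
    also have "\<dots> \<le> g N powr (- \<eta>) * (real (n + 1) powr (1 + \<epsilon>)) powr (2 * \<eta> - 1)"
    proof (intro mult_mono powr_mono2')
      show "g N \<le> g n" using mono that by (auto simp: incseq_def)
      show "real (n + 1) powr (1 + \<epsilon>) \<le> g n" using n0(2) that by auto
    qed (use \<eta> pos in auto)
    also have "(real (n + 1) powr (1 + \<epsilon>)) powr (2 * \<eta> - 1) = h n"
      unfolding h_def powr_powr \<eta>(3) ..
    finally show ?thesis .
  qed
  show sf: "summable f"
    using bound[OF _ order.refl]
    by (intro summable_comparison_test[OF _ summable_mult[OF h, of "g n0 powr (- \<eta>)"]]) auto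
  show "(\<lambda>N. (\<Sum>n<N. f n) - suminf f) \<in> O(\<lambda>N. g N powr (- \<eta>))"
  \<comment> \<open>The full sum of \<open>h\<close> bounds all its tails, which gives a constant
    independent of \<open>N\<close>.\<close>
  proof (intro bigoI[where c = "suminf h"] eventually_sequentiallyI[of n0])
    fix N assume N: "n0 \<le> N"
    have sh: "summable (\<lambda>n. h (n + N))" and shf: "summable (\<lambda>n. f (n + N))"
      using h sf by (simp_all add: summable_iff_shift)
    have sm: "summable (\<lambda>n. g N powr (- \<eta>) * h (n + N))"
      by (rule summable_mult[OF sh])
    have le: "\<bar>f (n + N)\<bar> \<le> g N powr (- \<eta>) * h (n + N)" for n
      using bound N by simp
    have sa: "summable (\<lambda>n. \<bar>f (n + N)\<bar>)"
      using le by (intro summable_comparison_test[OF _ sm]) auto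
    have "norm ((\<Sum>n<N. f n) - suminf f) = \<bar>\<Sum>n. f (n + N)\<bar>"
      using suminf_split_initial_segment[OF sf, of N] by simp
    also have "\<dots> \<le> (\<Sum>n. \<bar>f (n + N)\<bar>)"
      by (rule summable_rabs[OF sa])
    also have "\<dots> \<le> (\<Sum>n. g N powr (- \<eta>) * h (n + N))"
      by (rule suminf_le[OF le sa sm])
    also have "\<dots> = g N powr (- \<eta>) * (\<Sum>n. h (n + N))"
      by (rule suminf_mult[OF sh])
    also have "\<dots> \<le> g N powr (- \<eta>) * suminf h"
      using suminf_split_initial_segment[OF h, of N] sum_nonneg[of "{..<N}" h] h0
      by (intro mult_left_mono) auto
    finally show "norm ((\<Sum>n<N. f n) - suminf f) \<le> suminf h * norm (g N powr (- \<eta>))"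
      by (simp add: mult.commute)
  qed
qed

subsection \<open>Denominators\<close>

text \<open>\<open>Q\<close> clears the denominators of the coefficients, and the power
  \<open>D\<close> those of the monomials, whose exponents are at most \<open>D\<close>.
  \<open>Q\<close> is quantified before \<open>\<beta>\<close> and \<open>q\<close>, so one
  \<open>Q\<close> serves all partial sums.\<close>

lemma polynomial_clear_denominators:
  fixes c :: "(nat \<Rightarrow> nat) \<Rightarrow> rat"
  assumes S: "finite S" and D: "\<And>e k. e \<in> S \<Longrightarrow> k \<in> I \<Longrightarrow> e k \<le> D"
  shows "\<exists>Q::int. Q > 0 \<and> (\<forall>(\<beta> :: nat \<Rightarrow> real) q :: nat \<Rightarrow> int. (\<forall>k\<in>I. of_int (q k) * \<beta> k \<in> \<int>) \<longrightarrow>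
     of_int Q * (\<Prod>k\<in>I. of_int (q k)) ^ D * (\<Sum>e\<in>S. of_rat (c e) * (\<Prod>i\<in>I. \<beta> i ^ e i)) \<in> \<int>)"
proof (intro exI conjI allI impI)
  define Q where "Q = (\<Prod>e\<in>S. snd (quotient_of (c e)))"
  show "Q > 0"
    unfolding Q_def by (intro prod_pos) (simp add: quotient_of_denom_pos')
  fix \<beta> :: "nat \<Rightarrow> real" and q :: "nat \<Rightarrow> int"
  assume q: "\<forall>k\<in>I. of_int (q k) * \<beta> k \<in> \<int>"
  have "of_int Q * of_rat (c e) * (\<Prod>k\<in>I. real_of_int (q k) ^ D * \<beta> k ^ e k) \<in> \<int>" if e: "e \<in> S" for e
  proof -
    obtain u w where uw: "quotient_of (c e) = (u, w)" by fastforce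
    then have "c e = of_int u / of_int w" "w > 0"
      by (auto simp: quotient_of_div quotient_of_denom_pos)
    then have "of_rat (c e) * real_of_int w = real_of_int u"
      by (simp add: of_rat_divide)
    moreover have "Q = w * (\<Prod>e\<in>S - {e}. snd (quotient_of (c e)))"
      unfolding Q_def using S e uw by (simp add: prod.remove)
    ultimately have "of_int Q * of_rat (c e) =
        real_of_int (u * (\<Prod>e\<in>S - {e}. snd (quotient_of (c e))))"
      by (metis mult.assoc mult.commute of_int_mult)
    then have 1: "of_int Q * (of_rat (c e) :: real) \<in> \<int>"
      by (simp only: Ints_of_int)
    have "real_of_int (q k) ^ D * \<beta> k ^ e k \<in> \<int>" if k: "k \<in> I" for k
    proof -
      have "real_of_int (q k) ^ D = real_of_int (q k) ^ (D - e k) * real_of_int (q k) ^ e k"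
        using D[OF e k] by (simp flip: power_add)
      then have "real_of_int (q k) ^ D * \<beta> k ^ e k =
          real_of_int (q k) ^ (D - e k) * (real_of_int (q k) * \<beta> k) ^ e k"
        by (simp add: power_mult_distrib)
      then show ?thesis
        using q k by simp
    qed
    then have "(\<Prod>k\<in>I. real_of_int (q k) ^ D * \<beta> k ^ e k) \<in> \<int>"
      by (rule Ints_prod)
    with 1 show ?thesis
      by (rule Ints_mult)
  qed
  then have "(\<Sum>e\<in>S. of_int Q * of_rat (c e) * (\<Prod>k\<in>I. real_of_int (q k) ^ D * \<beta> k ^ e k)) \<in> \<int>"
    by (rule Ints_sum)
  also have "(\<Sum>e\<in>S. of_int Q * of_rat (c e) * (\<Prod>k\<in>I. real_of_int (q k) ^ D * \<beta> k ^ e k)) =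
      of_int Q * (\<Prod>k\<in>I. of_int (q k)) ^ D * (\<Sum>e\<in>S. of_rat (c e) * (\<Prod>i\<in>I. \<beta> i ^ e i))"
    by (simp add: sum_distrib_left prod.distrib prod_power_distrib mult_ac)
  finally show "of_int Q * (\<Prod>k\<in>I. of_int (q k)) ^ D *
      (\<Sum>e\<in>S. of_rat (c e) * (\<Prod>i\<in>I. \<beta> i ^ e i)) \<in> \<int>" .
qed

lemma prod_times_partial_sum_Ints:
  fixes x y :: "nat \<Rightarrow> int"
  assumes "\<And>n. 1 \<le> n \<Longrightarrow> x n \<noteq> 0"
  shows "real_of_int (\<Prod>n=1..N. x n) *
     (\<Sum>n<N. real_of_int (y (n + 1)) / real_of_int (x (n + 1))) \<in> \<int>"
proof (induction N)
  case 0
  then show ?case by simp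
next
  case (Suc N)
  have "real_of_int (\<Prod>n=1..Suc N. x n) *
        (\<Sum>n<Suc N. real_of_int (y (n + 1)) / real_of_int (x (n + 1))) =
      real_of_int (x (Suc N)) * (real_of_int (\<Prod>n=1..N. x n) *
        (\<Sum>n<N. real_of_int (y (n + 1)) / real_of_int (x (n + 1)))) +
      real_of_int ((\<Prod>n=1..N. x n) * y (Suc N))"
    using assms[of "Suc N"] by (simp add: field_simps)
  then show ?case
    using Suc by (simp only: Ints_add Ints_mult Ints_of_int)
qed

lemma log_prod:
  fixes f :: "'i \<Rightarrow> real"
  assumes "finite I" "\<And>i. i \<in> I \<Longrightarrow> f i > 0"
  shows "log B (\<Prod>i\<in>I. f i) = (\<Sum>i\<in>I. log B (f i))"
  using assms by (induction I rule: finite_induct) (auto simp: log_mult_pos prod_pos)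

text \<open>The finitely many exceptional indices contribute a bounded excess; \<open>C\<close> is
  the sum of the positive parts of \<open>f n - g n\<close> over them.\<close>

lemma sum_le_const_plus_sum:
  fixes f g :: "nat \<Rightarrow> real"
  assumes "\<forall>\<^sub>F n in sequentially. f n \<le> g n"
  shows "\<exists>C. \<forall>N. (\<Sum>n=1..N. f n) \<le> C + (\<Sum>n=1..N. g n)"
proof -
  obtain n0 where n0: "\<And>n. n \<ge> n0 \<Longrightarrow> f n \<le> g n"
    using assms unfolding eventually_sequentially by blast
  define d where "d n = max 0 (f n - g n)" for n
  have "(\<Sum>n=1..N. f n) \<le> (\<Sum>n<n0. d n) + (\<Sum>n=1..N. g n)" for N
  proof -
    have "(\<Sum>n=1..N. f n) \<le> (\<Sum>n=1..N. d n + g n)"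
      by (intro sum_mono) (auto simp: d_def)
    also have "\<dots> = (\<Sum>n=1..N. d n) + (\<Sum>n=1..N. g n)"
      by (rule sum.distrib)
    also have "(\<Sum>n=1..N. d n) = (\<Sum>n\<in>{1..N} \<inter> {..<n0}. d n)"
      using n0 by (intro sum.mono_neutral_right) (auto simp: d_def not_less)
    also have "\<dots> \<le> (\<Sum>n<n0. d n)"
      by (intro sum_mono2) (auto simp: d_def)
    finally show ?thesis by simp
  qed
  then show ?thesis by blast
qed

subsection \<open>Record indices\<close>

text \<open>The first index at which \<open>y\<close> exceeds a bound is a record; taking the bound
  no less than the values up to \<open>N0\<close> pushes that index past \<open>N0\<close>.\<close>

lemma exists_record_index:
  fixes y :: "nat \<Rightarrow> real"
  assumes "\<And>M. \<exists>n. y n > M"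
  shows "\<exists>N\<ge>N0. y (N + 1) > M \<and> (\<forall>n\<le>N. y n \<le> y (N + 1))"
proof -
  define M' where "M' = Max (insert M (y ` {..N0}))"
  define m where "m = (LEAST n. y n > M')"
  have m: "y m > M'"
    unfolding m_def using assms by (rule LeastI_ex)
  have below: "y n \<le> M'" if "n < m" for n
    using not_less_Least[of n "\<lambda>n. y n > M'"] that unfolding m_def by force
  have M': "M \<le> M'" "\<And>n. n \<le> N0 \<Longrightarrow> y n \<le> M'"
    unfolding M'_def by (auto intro!: Max_ge simp del: Max_insert)
  then have "m > N0"
    using m by (meson linorder_not_less)
  then obtain N where N: "m = N + 1" "N \<ge> N0"
    by (cases m) auto
  have "y n \<le> y (N + 1)" if "n \<le> N" for n
    using below[of n] m that N(1) by simp
  then show ?thesis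
    using m M'(1) N by (intro exI[of _ N]) auto
qed

text \<open>The record puts the earlier \<open>x n\<close> below a geometric progression of ratio
  \<open>B\<close> that reaches \<open>x (N + 1)\<close> at \<open>N + 1\<close>, so their sum is
  smaller by a factor \<open>B - 1\<close>. As the record value is at least \<open>1\<close>, the
  \<open>B ^ n\<close> obey the same bound, whence the constant \<open>3 = 2 + 1\<close>.\<close>

lemma record_sum_bound:
  fixes x :: "nat \<Rightarrow> real" and B :: real
  assumes B: "B > 1" and y: "x (N + 1) / B ^ (N + 1) \<ge> 1"
    and rec: "\<And>n. n \<le> N \<Longrightarrow> x n / B ^ n \<le> x (N + 1) / B ^ (N + 1)"
  shows "(\<Sum>n=1..N. 2 * x n + B ^ n) \<le> 3 * x (N + 1) / (B - 1)"
proof -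
  define Y where "Y = x (N + 1) / B ^ (N + 1)"
  have geo: "(\<Sum>n=1..N. B ^ n) \<le> B ^ (N + 1) / (B - 1)"
  proof -
    have "(\<Sum>n=1..N. B ^ n) \<le> (\<Sum>n<N + 1. B ^ n)"
      using B by (intro sum_mono2) auto
    also have "\<dots> = (B ^ (N + 1) - 1) / (B - 1)"
      using B by (subst geometric_sum) auto
    also have "\<dots> \<le> B ^ (N + 1) / (B - 1)"
      using B by (intro divide_right_mono) auto
    finally show ?thesis .
  qed
  have "(\<Sum>n=1..N. 2 * x n + B ^ n) \<le> (\<Sum>n=1..N. 3 * Y * B ^ n)"
  proof (intro sum_mono)
    fix n assume "n \<in> {1..N}"
    then have "x n \<le> Y * B ^ n"
      using rec[of n] B unfolding Y_def by (simp add: pos_divide_le_eq)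
    moreover have "1 * B ^ n \<le> Y * B ^ n"
      using y B unfolding Y_def by (intro mult_right_mono) auto
    ultimately show "2 * x n + B ^ n \<le> 3 * Y * B ^ n"
      by simp
  qed
  also have "\<dots> = 3 * Y * (\<Sum>n=1..N. B ^ n)"
    by (simp add: sum_distrib_left)
  also have "\<dots> \<le> 3 * Y * (B ^ (N + 1) / (B - 1))"
    using y unfolding Y_def by (intro mult_left_mono[OF geo]) auto
  also have "\<dots> = 3 * x (N + 1) / (B - 1)"
    unfolding Y_def using B by simp
  finally show ?thesis .
qed

lemma eventually_powr_le_linear:
  fixes \<kappa> \<delta> :: real
  assumes "\<kappa> < 1" "\<delta> > 0"
  shows "\<forall>\<^sub>F x in at_top. x powr \<kappa> \<le> \<delta> * x"
proof -
  \<comment> \<open>Beyond this threshold \<open>x powr (1 - \<kappa>)\<close> is at least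
    \<open>1 / \<delta>\<close>.\<close>
  have "\<forall>\<^sub>F x in at_top. x \<ge> (1 / \<delta>) powr (1 / (1 - \<kappa>))"
    by (rule eventually_ge_at_top)
  then show ?thesis
    using eventually_gt_at_top[of 0]
  proof eventually_elim
    case (elim x)
    have "((1 / \<delta>) powr (1 / (1 - \<kappa>))) powr (1 - \<kappa>) \<le> x powr (1 - \<kappa>)"
      using elim assms by (intro powr_mono2) auto
    then have "1 / \<delta> \<le> x powr (1 - \<kappa>)"
      using assms by (simp add: powr_powr)
    then have "1 \<le> \<delta> * x powr (1 - \<kappa>)"
      using assms by (simp add: field_simps)
    then have "1 * x powr \<kappa> \<le> \<delta> * x powr (1 - \<kappa>) * x powr \<kappa>"
      by (rule mult_right_mono) simp
    also have "\<dots> = \<delta> * x"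
      using elim by (simp add: mult.assoc flip: powr_add)
    finally show ?case by simp
  qed
qed

subsection \<open>Algebraic independence\<close>

lemma exponents_bounded:
  fixes S :: "(nat \<Rightarrow> nat) set"
  assumes "finite S"
  shows "\<exists>D. \<forall>e\<in>S. \<forall>k\<in>{1..K}. e k \<le> D"
proof -
  have "finite (\<Union>e\<in>S. e ` {1..K})"
    using assms by auto
  then show ?thesis
    unfolding finite_nat_set_iff_bounded_le by blast
qed

text \<open>One prime \<open>p\<close>, fixed by the coefficients alone, works for all large
  \<open>N\<close>: the partial sums then have poles of the orders that
  \<open>polynomial_nonzero_of_poles\<close> asks for.\<close>

lemma partial_sums_polynomial_nonzero:
  fixes a b :: "nat \<Rightarrow> nat \<Rightarrow> int" and c :: "(nat \<Rightarrow> nat) \<Rightarrow> rat"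
  assumes P_inf: "infinite P" and P_primes: "\<forall>p\<in>P. prime p" and K_pos: "K \<ge> 1"
    and a_nz: "\<forall>k\<in>{1..K}. \<forall>n\<ge>1. a k n \<noteq> 0"
    and coprime_p: "\<forall>p\<in>P. \<forall>k\<in>{1..K}. \<forall>n\<ge>1. \<not> int p dvd gcd (a k n) (b k n)"
    and unique_max: "\<forall>p\<in>P. \<forall>k\<in>{1..K}. eventually (\<lambda>N.
           \<exists>!n. 1 \<le> n \<and> n \<le> N \<and> padic_val p (a k n) = maxval p (a k) N) sequentially"
    and ratio: "\<forall>p\<in>P. \<forall>k\<in>{1..K}. k > 1 \<longrightarrow>
           filterlim (\<lambda>N. real (maxval p (a k) N) / (1 + real (maxval p (a (k - 1)) N)))
             at_top sequentially"
    and S: "finite S" "S \<noteq> {}" "S \<subseteq> {e. \<forall>i. i \<notin> {1..K} \<longrightarrow> e i = 0}"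
    and c: "\<And>e. e \<in> S \<Longrightarrow> c e \<noteq> 0"
  shows "\<forall>\<^sub>F N in sequentially. (\<Sum>e\<in>S. of_rat (c e) *
     (\<Prod>i\<in>{1..K}. (\<Sum>n<N. real_of_int (b i (n + 1)) / real_of_int (a i (n + 1))) ^ e i)) \<noteq> 0"
proof -
  obtain D where D: "\<And>e k. e \<in> S \<Longrightarrow> k \<in> {1..K} \<Longrightarrow> e k \<le> D"
    using exponents_bounded[OF S(1)] by blast
  \<comment> \<open>A prime dividing no member of \<open>Z\<close> makes every coefficient a p-adic
    unit; \<open>c e \<noteq> 0\<close> keeps \<open>0\<close> out of \<open>Z\<close>.\<close>
  define Z where "Z = (\<lambda>e. fst (quotient_of (c e))) ` S \<union> (\<lambda>e. snd (quotient_of (c e))) ` S"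
  have "fst (quotient_of (c e)) \<noteq> 0" if "e \<in> S" for e
    using c[OF that] quotient_of_div[of "c e"] by (cases "quotient_of (c e)") auto
  moreover have "snd (quotient_of (c e)) \<noteq> 0" for e
    using quotient_of_denom_pos'[of "c e"] by simp
  ultimately have "0 \<notin> Z"
    unfolding Z_def by fastforce
  then obtain p where pP: "p \<in> P" and pZ: "\<forall>z\<in>Z. \<not> int p dvd z"
    using exists_prime_avoiding[OF P_inf, of Z] S(1) unfolding Z_def by auto
  have p: "prime p" using pP P_primes by blast
  have "\<forall>\<^sub>F N in sequentially. \<forall>k\<in>{1..K}.
      \<exists>!n. 1 \<le> n \<and> n \<le> N \<and> padic_val p (a k n) = maxval p (a k) N"
    using unique_max pP by (intro eventually_ball_finite) auto
  \<comment> \<open>A ratio of at least \<open>D + 1\<close> makes the maximal valuations place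
    values for exponents up to \<open>D\<close>.\<close>
  moreover have "\<forall>\<^sub>F N in sequentially. \<forall>k\<in>{1..K}. 1 < k \<longrightarrow>
      real (D + 1) \<le> real (maxval p (a k) N) / (1 + real (maxval p (a (k - 1)) N))"
    using ratio pP unfolding filterlim_at_top by (intro eventually_ball_finite) auto
  moreover have "\<forall>\<^sub>F N :: nat in sequentially. 2 \<le> N"
    by (rule eventually_ge_at_top)
  ultimately show ?thesis
  proof eventually_elim
    case (elim N)
    define M where "M k = maxval p (a k) N" for k
    have poles: "0 < M k"
        "pole_eq p (\<Sum>n<N. real_of_int (b k (n + 1)) / real_of_int (a k (n + 1))) (M k)"
      if "k \<in> {1..K}" for k
      unfolding M_def using pole_eq_partial_sum[OF p, of "a k" "b k" N] a_nz coprime_p that elim pP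
      by blast+
    have M: "(D + 1) * M (k - 1) \<le> M k" if "1 < k" "k \<le> K" for k
    proof -
      have "real (D + 1) \<le> real (M k) / (1 + real (M (k - 1)))"
        using elim(2) that unfolding M_def by auto
      then have "real (D + 1) * (1 + real (M (k - 1))) \<le> real (M k)"
        by (simp add: pos_le_divide_eq add_pos_nonneg)
      then have "real ((D + 1) * (1 + M (k - 1))) \<le> real (M k)"
        by (simp only: of_nat_mult of_nat_add of_nat_1)
      then have "(D + 1) * (1 + M (k - 1)) \<le> M k"
        by (simp only: of_nat_le_iff)
      then show ?thesis by simp
    qed
    have c_poles: "pole_eq p (of_rat (c e)) 0" if "e \<in> S" for e
      using pZ that unfolding Z_def by (intro pole_eq_of_rat[OF p]) auto
    show ?case
      by (rule polynomial_nonzero_of_poles[where M = M and D = D, OF p S])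
        (use D c_poles poles M K_pos in auto)
  qed
qed

lemma frequently_large_of_limsup:
  fixes f :: "nat \<Rightarrow> real"
  assumes "limsup (\<lambda>n. ereal (f n)) = \<infinity>"
  shows "\<exists>n\<ge>N0. f n > M"
proof (rule ccontr)
  assume "\<not> ?thesis"
  then have "\<forall>\<^sub>F n in sequentially. ereal (f n) \<le> ereal M"
    unfolding eventually_sequentially by (metis ereal_less_eq(3) linorder_not_less)
  then have "limsup (\<lambda>n. ereal (f n)) \<le> ereal M"
    by (rule Limsup_bounded)
  with assms show False by simp
qed

theorem theorem6:
  fixes K :: nat and P :: "nat set" and \<epsilon> \<kappa> :: real
    and a b :: "nat \<Rightarrow> nat \<Rightarrow> int" and aa :: "nat \<Rightarrow> nat" and A0 :: int
  assumes K_pos: "K \<ge> 1"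
    and P_inf: "infinite P" and P_primes: "\<forall>p\<in>P. prime p"
    and eps_pos: "\<epsilon> > 0" and kappa_pos: "\<kappa> > 0" and kappa_lt1: "\<kappa> < 1"
    and a_nz: "\<forall>k\<in>{1..K}. \<forall>n\<ge>1. a k n \<noteq> 0"
    and b_nz: "\<forall>k\<in>{1..K}. \<forall>n\<ge>1. b k n \<noteq> 0"
    and a0: "\<forall>n\<ge>1. a 0 n = 1"
    and coprime_p: "\<forall>p\<in>P. \<forall>k\<in>{1..K}. \<forall>n\<ge>1. \<not> int p dvd gcd (a k n) (b k n)"
    and unique_max: "\<forall>p\<in>P. \<forall>k\<in>{1..K}. eventually (\<lambda>N.
           \<exists>!n. 1 \<le> n \<and> n \<le> N \<and> padic_val p (a k n) = maxval p (a k) N) sequentially"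
    and ratio: "\<forall>p\<in>P. \<forall>k\<in>{1..K}. k > 1 \<longrightarrow>
           filterlim (\<lambda>N. real (maxval p (a k) N) / (1 + real (maxval p (a (k - 1)) N)))
             at_top sequentially"
    and aa_pos: "\<forall>n\<ge>1. aa n > 0"
    and aa_mono: "\<forall>n\<ge>1. aa n \<le> aa (n + 1)"
    and growth: "\<forall>k\<in>{1..K}. \<forall>A::int. A \<ge> A0 \<longrightarrow> eventually (\<lambda>n.
           real n powr (1 + \<epsilon>) \<le> real (aa n) \<and> aa n \<le> aa (n + 1) \<and>
           \<bar>real_of_int (b k n)\<bar> \<le> 2 powr (log 2 (real (aa n)) powr \<kappa>) \<and>
           real (aa n) * 2 powr (- (log 2 (real (aa n)) powr \<kappa>)) \<le> \<bar>real_of_int (a k n)\<bar> \<and>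
           \<bar>real_of_int (a k n)\<bar> \<le> max (real (aa n) * 2 powr (log 2 (real (aa n)) powr \<kappa>))
                                         (2 powr (real_of_int A ^ n))) sequentially"
    and limsup_inf: "\<forall>A::int. A \<ge> A0 \<longrightarrow>
           limsup (\<lambda>n. ereal (real (aa n) powr (1 / real_of_int A ^ n))) = \<infinity>"
  shows "alg_indep_over_rat K
           (\<lambda>k. \<Sum>n. real_of_int (b k (n + 1)) / real_of_int (a k (n + 1)))"
proof (rule ccontr)

  \<comment> \<open>Reduction to a vanishing polynomial with non-zero coefficients\<close>
  define \<alpha> where "\<alpha> k = (\<Sum>n. real_of_int (b k (n + 1)) / real_of_int (a k (n + 1)))" for k
  define \<beta> where "\<beta> N k = (\<Sum>n<N. real_of_int (b k (n + 1)) / real_of_int (a k (n + 1)))" for N k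
  assume "\<not> alg_indep_over_rat K
           (\<lambda>k. \<Sum>n. real_of_int (b k (n + 1)) / real_of_int (a k (n + 1)))"
  then obtain S0 and c :: "(nat \<Rightarrow> nat) \<Rightarrow> rat" and e0 where
    S0: "finite S0" "S0 \<subseteq> {e. \<forall>i. i \<notin> {1..K} \<longrightarrow> e i = 0}"
      "(\<Sum>e\<in>S0. of_rat (c e) * (\<Prod>i\<in>{1..K}. \<alpha> i ^ e i)) = 0" "e0 \<in> S0" "c e0 \<noteq> 0"
    unfolding alg_indep_over_rat_def \<alpha>_def by blast
  define S where "S = {e \<in> S0. c e \<noteq> 0}"
  have S: "finite S" "S \<noteq> {}" "S \<subseteq> {e. \<forall>i. i \<notin> {1..K} \<longrightarrow> e i = 0}" "\<And>e. e \<in> S \<Longrightarrow> c e \<noteq> 0"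
    using S0 unfolding S_def by auto
  have "(\<Sum>e\<in>S. of_rat (c e) * (\<Prod>i\<in>{1..K}. \<alpha> i ^ e i)) =
      (\<Sum>e\<in>S0. of_rat (c e) * (\<Prod>i\<in>{1..K}. \<alpha> i ^ e i))"
    unfolding S_def using S0(1) by (intro sum.mono_neutral_left) auto
  then have root: "(\<Sum>e\<in>S. of_rat (c e) * (\<Prod>i\<in>{1..K}. \<alpha> i ^ e i)) = 0"
    using S0(3) by simp
  obtain D where D: "\<And>e k. e \<in> S \<Longrightarrow> k \<in> {1..K} \<Longrightarrow> e k \<le> D"
    using exponents_bounded[OF S(1)] by blast
  define F where "F N = (\<Sum>e\<in>S. of_rat (c e) * (\<Prod>i\<in>{1..K}. \<beta> N i ^ e i))" for N
  define x where "x n = log 2 (real (aa n))" for n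
  define \<eta> where "\<eta> = \<epsilon> / (4 * (1 + \<epsilon>))"
  have \<eta>: "\<eta> > 0"
    using eps_pos by (simp add: \<eta>_def)
  have aa_powr: "real (aa n) = 2 powr x n" if "n \<ge> 1" for n
    using aa_pos that by (simp add: x_def)

  \<comment> \<open>\<open>B \<ge> A0\<close> lets the hypotheses apply with \<open>A = B\<close>.
    The last bound makes \<open>3 * K * D / (B - 1)\<close> at most \<open>\<eta> / 2\<close>, so
    the denominators consume at most half of the exponent gained from the tails.\<close>
  define B where "B = max (max A0 2) (\<lceil>1 + 6 * real K * real D / \<eta>\<rceil>)"
  have B: "B \<ge> A0" "real_of_int B \<ge> 2" "real_of_int B \<ge> 1 + 6 * real K * real D / \<eta>"
    unfolding B_def by (auto simp: of_int_max le_max_iff_disj) 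
  have gr: "\<forall>\<^sub>F n in sequentially. real n powr (1 + \<epsilon>) \<le> real (aa n) \<and>
           \<bar>real_of_int (b k n)\<bar> \<le> 2 powr (x n powr \<kappa>) \<and>
           real (aa n) * 2 powr (- (x n powr \<kappa>)) \<le> \<bar>real_of_int (a k n)\<bar> \<and>
           \<bar>real_of_int (a k n)\<bar> \<le> max (real (aa n) * 2 powr (x n powr \<kappa>))
                                         (2 powr (real_of_int B ^ n))" if "k \<in> {1..K}" for k
    unfolding x_def using growth[rule_format, OF that B(1)] by eventually_elim auto
  have aa_large: "\<forall>\<^sub>F n in sequentially. real n powr (1 + \<epsilon>) \<le> real (aa n)"
    using gr[of 1] K_pos by (auto elim: eventually_mono)
  have x_lim: "filterlim x at_top sequentially"
  proof -
    have "\<forall>\<^sub>F n in sequentially. log 2 (real n) \<le> x n"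
      using aa_large eventually_ge_at_top[of 1]
    proof eventually_elim
      case (elim n)
      have "real n powr 1 \<le> real n powr (1 + \<epsilon>)"
        using elim eps_pos by (intro powr_mono) auto
      then have "real n \<le> real (aa n)"
        using elim by simp
      then show ?case
        unfolding x_def using elim by (subst log_le_cancel_iff) auto
    qed
    moreover have "filterlim (\<lambda>n. log 2 (real n)) at_top sequentially"
    proof -
      have "filterlim (\<lambda>n. ln (real n)) at_top sequentially"
        by (rule filterlim_compose[OF ln_at_top filterlim_real_sequentially])
      then have "filterlim (\<lambda>n. (1 / ln 2) * ln (real n)) at_top sequentially"
        by (rule filterlim_tendsto_pos_mult_at_top[OF tendsto_const, rotated]) auto
      then show ?thesis
        by (simp add: log_def)
    qed
    ultimately show ?thesis
      by (rule filterlim_at_top_mono[rotated])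
  qed
  \<comment> \<open>Thus the factors \<open>2 powr (x n powr \<kappa>)\<close> are eventually below
    any fixed positive power of \<open>aa n\<close>.\<close>
  have x_kappa: "\<forall>\<^sub>F n in sequentially. x n powr \<kappa> \<le> \<delta> * x n" if "\<delta> > 0" for \<delta>
    using eventually_compose_filterlim[OF eventually_powr_le_linear[OF kappa_lt1 that] x_lim] .
  have x_pos: "\<forall>\<^sub>F n in sequentially. x n > 0"
    using x_lim unfolding filterlim_at_top_dense by blast

  \<comment> \<open>Upper bound from the tails of the series\<close>
  define t where "t N = real (aa (N + 1)) powr (- \<eta>)" for N
  \<comment> \<open>\<open>\<beta> N k\<close> uses the indices \<open>1\<close> to
    \<open>N\<close>, so the first omitted index is \<open>N + 1\<close>, as in
    \<open>t\<close>.\<close>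
  have "(\<lambda>N. \<beta> N k - \<alpha> k) \<in> O(t)" if k: "k \<in> {1..K}" for k
    unfolding \<beta>_def \<alpha>_def t_def \<eta>_def
  proof (rule tail_bigo(2)[where g = "\<lambda>n. real (aa (n + 1))", OF eps_pos])
    show "incseq (\<lambda>n. real (aa (n + 1)))"
      using aa_mono by (intro incseq_SucI) auto
    show "real (aa (n + 1)) > 0" for n
      using aa_pos by simp
    show "\<forall>\<^sub>F n in sequentially. real (n + 1) powr (1 + \<epsilon>) \<le> real (aa (n + 1))"
      using eventually_sequentially_Suc[THEN iffD2, OF aa_large] by simp
    \<comment> \<open>Numerator and denominator each cost at most a factor
      \<open>aa n powr (\<eta> / 2)\<close>, hence \<open>x_kappa\<close> with half of
      \<open>\<eta>\<close>.\<close>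
    have "\<forall>\<^sub>F n in sequentially. \<bar>real_of_int (b k n) / real_of_int (a k n)\<bar> \<le> real (aa n) powr (\<eta> - 1)"
      using gr[OF k] x_kappa[OF half_gt_zero[OF \<eta>]] eventually_ge_at_top[of 1]
    proof eventually_elim
      case (elim n)
      then have le: "x n powr \<kappa> \<le> \<eta> / 2 * x n" and n: "aa n > 0"
        using \<eta> aa_pos by auto
      have "\<bar>real_of_int (b k n) / real_of_int (a k n)\<bar> \<le>
          2 powr (x n powr \<kappa>) / (real (aa n) * 2 powr (- (x n powr \<kappa>)))"
        unfolding abs_divide using elim n by (intro frac_le) auto
      also have "\<dots> = 2 powr (2 * x n powr \<kappa> - x n)"
        using aa_powr[of n] elim by (simp flip: powr_add powr_diff)
      also have "\<dots> \<le> 2 powr (x n * (\<eta> - 1))"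
        using le by (intro powr_mono) (auto simp: algebra_simps)
      also have "\<dots> = real (aa n) powr (\<eta> - 1)"
        using aa_powr[of n] elim by (simp add: powr_powr)
      finally show ?case .
    qed
    then show "\<forall>\<^sub>F n in sequentially. \<bar>real_of_int (b k (n + 1)) / real_of_int (a k (n + 1))\<bar>
        \<le> real (aa (n + 1)) powr (\<epsilon> / (4 * (1 + \<epsilon>)) - 1)"
      unfolding \<eta>_def
      using eventually_sequentially_Suc[of "\<lambda>n. \<bar>real_of_int (b k n) / real_of_int (a k n)\<bar>
        \<le> real (aa n) powr (\<epsilon> / (4 * (1 + \<epsilon>)) - 1)"] by simp
  qed
  moreover have "t \<in> O(\<lambda>_. 1)"
  proof (intro bigoI[where c = 1] always_eventually allI)
    fix N
    have "real (aa (N + 1)) \<ge> 1"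
      using aa_pos[rule_format, of "N + 1"] by simp
    then show "norm (t N) \<le> 1 * norm (1::real)"
      unfolding t_def using \<eta> powr_mono[of "- \<eta>" 0 "real (aa (N + 1))"] by simp
  qed
  ultimately have "F \<in> O(t)"
    using bigo_diff_polynomial[of "{1..K}" \<beta> \<alpha> t "\<lambda>e. of_rat (c e)" S] root
    unfolding F_def by simp
  then obtain C1 where C1: "C1 > 0" "\<forall>\<^sub>F N in sequentially. norm (F N) \<le> C1 * norm (t N)"
    by (elim landau_o.bigE)

  \<comment> \<open>Integrality, non-vanishing and size of the common denominators\<close>
  obtain Q :: int where Q: "Q > 0" and clear: "\<And>(\<beta> :: nat \<Rightarrow> real) q :: nat \<Rightarrow> int.
      \<forall>k\<in>{1..K}. of_int (q k) * \<beta> k \<in> \<int> \<Longrightarrow>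
      of_int Q * (\<Prod>k\<in>{1..K}. of_int (q k)) ^ D *
        (\<Sum>e\<in>S. of_rat (c e) * (\<Prod>i\<in>{1..K}. \<beta> i ^ e i)) \<in> \<int>"
    using polynomial_clear_denominators[where I = "{1..K}" and D = D and c = c, OF S(1)] D by blast
  define q where "q N k = (\<Prod>n=1..N. a k n)" for N k
  have q_nz: "q N k \<noteq> 0" if "k \<in> {1..K}" for N k
    unfolding q_def using a_nz that by auto
  have integral: "of_int Q * (\<Prod>k\<in>{1..K}. of_int (q N k)) ^ D * F N \<in> \<int>" for N
    unfolding F_def using a_nz
    by (intro clear ballI) (auto simp only: q_def \<beta>_def intro!: prod_times_partial_sum_Ints)
  have F_nz: "\<forall>\<^sub>F N in sequentially. F N \<noteq> 0"
    unfolding F_def \<beta>_def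
    by (rule partial_sums_polynomial_nonzero[OF P_inf P_primes K_pos a_nz coprime_p unique_max ratio S])

  have "\<exists>C. \<forall>N. log 2 \<bar>real_of_int (q N k)\<bar> \<le> C + (\<Sum>n=1..N. 2 * x n + real_of_int B ^ n)"
    if k: "k \<in> {1..K}" for k
  proof -
    \<comment> \<open>Adding exponents absorbs both alternatives of the \<open>max\<close>: the
      first is at most \<open>2 powr (2 * x n)\<close>, and \<open>x n > 0\<close> covers the
      second.\<close>
    have "\<forall>\<^sub>F n in sequentially. log 2 \<bar>real_of_int (a k n)\<bar> \<le> 2 * x n + real_of_int B ^ n"
      using gr[OF k] x_kappa[OF zero_less_one] x_pos eventually_ge_at_top[of 1]
    proof eventually_elim
      case (elim n)
      have "0 \<le> real_of_int B ^ n"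
        using B by simp
      then have "real (aa n) * 2 powr (x n powr \<kappa>) \<le> 2 powr (2 * x n + real_of_int B ^ n)"
        using elim aa_powr[of n] by (auto simp flip: powr_add)
      moreover have "2 powr (real_of_int B ^ n) \<le> 2 powr (2 * x n + real_of_int B ^ n)"
        using elim by simp
      ultimately have "\<bar>real_of_int (a k n)\<bar> \<le> 2 powr (2 * x n + real_of_int B ^ n)"
        using elim by linarith
      moreover have "\<bar>real_of_int (a k n)\<bar> > 0"
        using a_nz k elim by simp
      ultimately show ?case
        by (simp add: log_le_iff)
    qed
    from sum_le_const_plus_sum[OF this] obtain C where C: "\<And>N. (\<Sum>n=1..N. log 2 \<bar>real_of_int (a k n)\<bar>) \<le>
        C + (\<Sum>n=1..N. 2 * x n + real_of_int B ^ n)"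
      by blast
    have "log 2 \<bar>real_of_int (q N k)\<bar> = (\<Sum>n=1..N. log 2 \<bar>real_of_int (a k n)\<bar>)" for N
      unfolding q_def of_int_prod abs_prod using a_nz k by (subst log_prod) auto
    with C show ?thesis by auto
  qed
  then obtain C where C: "\<And>k N. k \<in> {1..K} \<Longrightarrow>
      log 2 \<bar>real_of_int (q N k)\<bar> \<le> C k + (\<Sum>n=1..N. 2 * x n + real_of_int B ^ n)"
    by metis

  \<comment> \<open>Choice of the record index\<close>
  obtain N0 where N0: "\<And>N. N \<ge> N0 \<Longrightarrow> F N \<noteq> 0 \<and> norm (F N) \<le> C1 * norm (t N)"
    using eventually_conj[OF F_nz C1(2)] unfolding eventually_sequentially by blast
  \<comment> \<open>\<open>C2\<close> gathers the terms independent of \<open>N\<close> in the final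
    logarithmic inequality.\<close>
  define C2 where "C2 = log 2 C1 + log 2 (real_of_int Q) + real D * (\<Sum>k=1..K. C k)"
  \<comment> \<open>\<open>x n / B ^ n\<close> is the binary logarithm of the expression in the
    limsup hypothesis.\<close>
  have "\<exists>n. x n / real_of_int B ^ n > M" for M
  proof -
    obtain n where n: "n \<ge> 1" "real (aa n) powr (1 / real_of_int B ^ n) > 2 powr M"
      using frequently_large_of_limsup[OF limsup_inf[rule_format, OF B(1)]] by blast
    then have "2 powr M < 2 powr (x n / real_of_int B ^ n)"
      using aa_powr[of n] by (simp add: powr_powr)
    then show ?thesis
      by (auto simp: powr_less_cancel_iff)
  qed
  \<comment> \<open>The bound \<open>1\<close> serves \<open>record_sum_bound\<close>; the other
    makes \<open>\<eta> / 2 * X\<close> exceed \<open>C2\<close>.\<close>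
  from exists_record_index[OF this, of N0 "max 1 (2 * C2 / \<eta>)"]
  obtain N where N: "N \<ge> N0" "x (N + 1) / real_of_int B ^ (N + 1) > max 1 (2 * C2 / \<eta>)"
      "\<And>n. n \<le> N \<Longrightarrow> x n / real_of_int B ^ n \<le> x (N + 1) / real_of_int B ^ (N + 1)"
    by blast
  define X where "X = x (N + 1)"
  have BN: "real_of_int B ^ (N + 1) \<ge> 1"
    using B by (intro one_le_power) auto
  then have "1 * real_of_int B ^ (N + 1) < X"
    using N(2) unfolding X_def by (simp add: pos_less_divide_eq)
  then have X0: "X > 0"
    using BN by linarith
  \<comment> \<open>The record bounds the quotient from below; as the power is at least
    \<open>1\<close>, the bound passes to \<open>X\<close>.\<close>
  have "X / real_of_int B ^ (N + 1) \<le> X / 1"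
    using BN X0 by (intro divide_left_mono) auto
  then have X: "2 * C2 / \<eta> < X"
    using N(2) unfolding X_def by simp
  have "(\<Sum>n=1..N. 2 * x n + real_of_int B ^ n) \<le> 3 * X / (real_of_int B - 1)"
    unfolding X_def using B N by (intro record_sum_bound) auto
  then have logq: "log 2 \<bar>real_of_int (q N k)\<bar> \<le> C k + 3 * X / (real_of_int B - 1)" if "k \<in> {1..K}" for k
    using C[OF that, of N] by linarith

  \<comment> \<open>Comparison of the two bounds\<close>
  define W where "W = (\<Prod>k\<in>{1..K}. \<bar>real_of_int (q N k)\<bar>)"
  have W: "W > 0"
    unfolding W_def using q_nz by (intro prod_pos) auto
  have F: "F N \<noteq> 0" "\<bar>F N\<bar> \<le> C1 * t N" "t N > 0"
    using N0[OF N(1)] aa_pos unfolding t_def by auto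
  have "of_int Q * (\<Prod>k\<in>{1..K}. of_int (q N k)) ^ D * F N \<noteq> 0"
    using Q q_nz F(1) by simp
  \<comment> \<open>A non-zero integer has absolute value at least \<open>1\<close>; the chain
    bounds it above by the tail estimate and takes logarithms.\<close>
  then have "1 \<le> \<bar>of_int Q * (\<Prod>k\<in>{1..K}. of_int (q N k)) ^ D * F N\<bar>"
    using integral[of N] Ints_nonzero_abs_ge1 by blast
  also have "\<dots> = of_int Q * W ^ D * \<bar>F N\<bar>"
    using Q by (simp add: abs_mult power_abs abs_prod W_def)
  also have "\<dots> \<le> of_int Q * W ^ D * (C1 * t N)"
    using Q W F by (intro mult_left_mono) auto
  finally have "log 2 1 \<le> log 2 (of_int Q * W ^ D * (C1 * t N))"
    using Q W F C1(1) by (subst log_le_cancel_iff) auto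
  also have "\<dots> = log 2 (real_of_int Q) + real D * log 2 W + (log 2 C1 + log 2 (t N))"
    using Q W F C1(1) by (simp add: log_mult log_nat_power)
  also have "log 2 (t N) = - \<eta> * X"
    unfolding t_def X_def x_def using aa_pos[rule_format, of "N + 1"] by (simp add: log_powr)
  also have "log 2 W = (\<Sum>k=1..K. log 2 \<bar>real_of_int (q N k)\<bar>)"
    unfolding W_def using q_nz by (subst log_prod) auto
  finally have "0 \<le> log 2 (real_of_int Q) + real D * (\<Sum>k=1..K. log 2 \<bar>real_of_int (q N k)\<bar>) +
      (log 2 C1 - \<eta> * X)"
    by simp
  moreover have "(\<Sum>k=1..K. log 2 \<bar>real_of_int (q N k)\<bar>) \<le> (\<Sum>k=1..K. C k + 3 * X / (real_of_int B - 1))"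
    using logq by (rule sum_mono)
  then have "real D * (\<Sum>k=1..K. log 2 \<bar>real_of_int (q N k)\<bar>) \<le>
      real D * ((\<Sum>k=1..K. C k) + real K * (3 * X / (real_of_int B - 1)))"
    by (intro mult_left_mono) (auto simp: sum.distrib)
  moreover have "real D * (real K * (3 * X / (real_of_int B - 1))) \<le> \<eta> / 2 * X"
  proof -
    have "6 * real K * real D \<le> \<eta> * (real_of_int B - 1)"
      using B(3) \<eta> by (simp add: field_simps)
    then have "X * (6 * real K * real D) \<le> X * (\<eta> * (real_of_int B - 1))"
      using X0 by (intro mult_left_mono) auto
    then show ?thesis
      using B(2) by (simp add: field_simps)
  qed
  \<comment> \<open>The other half of \<open>\<eta> * X\<close> would be at most \<open>C2\<close>,
    contrary to the choice of the record.\<close>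
  ultimately have "0 \<le> C2 - \<eta> / 2 * X"
    unfolding C2_def by (simp add: distrib_left)
  then show False
    using X \<eta> by (simp add: field_simps)
qed

end
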